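(* $\mathbf{nbI}$ is not characterizable by a finite Nmatrix; that is, there is no Nmatrix $\mathcal M=(\mathcal A,D)$ over $\Sigma_{\mathbf{nbI}}$ with finite universe such that, for every set of formulas $\Gamma\cup\{\varphi\}\subseteq\mathbf F(\Sigma_{\mathbf{nbI}},\mathcal V)$, $\Gamma\vdash_{\mathbf{nbI}}\varphi$ if and only if $\Gamma\vDash_{\mathcal M}\varphi$.
   Context: Let $\mathcal V$ be a countably infinite set of propositional variables and $\Sigma_{\mathbf{nbI}}=\{\vee,\wedge,\rightarrow,\uparrow,\neg\}$ with $\neg$ unary and the other connectives binary; $\mathbf F(\Sigma_{\mathbf{nbI}},\mathcal V)$ is the set of formulas. The logic $\mathbf{nbI}$ is the Hilbert calculus whose only inference rule is Modus Ponens and whose axioms are all instances (with arbitrary formulas) of: (1) $\alpha\to(\beta\to\alpha)$; (2) $(\alpha\to(\beta\to\gamma))\to((\alpha\to\beta)\to(\alpha\to\gamma))$; (3) $\alpha\to(\beta\to(\alpha\wedge\beta))$; (4) $(\alpha\wedge\beta)\to\alpha$; (5) $(\alpha\wedge\beta)\to\beta$; (6) $\alpha\to(\alpha\vee\beta)$; (7) $\beta\to(\alpha\vee\beta)$; (8) $(\alpha\to\gamma)\to((\beta\to\gamma)\to((\alpha\vee\beta)\to\gamma))$; (9) $(\alpha\to\beta)\vee\alpha$; (Ip) $(\alpha\uparrow\beta)\to(\alpha\to(\beta\to\gamma))$; (Comm) $(\alpha\uparrow\beta)\to(\beta\uparrow\alpha)$; (11) $\alpha\vee\neg\alpha$. $\Gamma\vdash_{\mathbf{nbI}}\varphi$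 means that there is a finite derivation of $\varphi$ from premises in $\Gamma$. A non-deterministic matrix (Nmatrix) over a signature $\Sigma$ is a pair $\mathcal M=(\mathcal A,D)$ where $\mathcal A$ is a $\Sigma$-multialgebra with universe $A$ (each $n$-ary connective $\sigma$ is interpreted as a function $\sigma_{\mathcal A}:A^n\to\wp(A)\setminus\{\emptyset\}$) and $D$ is a proper nonempty subset of $A$. A valuation over $\mathcal M$ is a map $\nu:\mathbf F(\Sigma,\mathcal V)\to A$ with $\nu(\sigma(\varphi_1,\dots,\varphi_n))\in\sigma_{\mathcal A}(\nu(\varphi_1),\dots,\nu(\varphi_n))$ for all connectives $\sigma$ and formulas $\varphi_i$. $\Gamma\vDash_{\mathcal M}\varphi$ means: for every valuation $\nu$ over $\mathcal M$, if $\nu(\gamma)\in D$ for all $\gamma\in\Gamma$ then $\nu(\varphi)\in D$. *)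

theory Defs
  imports Main "HOL-Library.Countable_Set"
begin

text \<open>Formulas over the signature of nbI; the variables are the elements of the type \<open>'v\<close>.\<close>

datatype 'v fm =
    Var 'v
  | Disj "'v fm" "'v fm"
  | Conj "'v fm" "'v fm"
  | Imp "'v fm" "'v fm"
  | Inc "'v fm" "'v fm"   \<comment> \<open>the incompatibility connective \<open>\<up>\<close>\<close>
  | Neg "'v fm"

inductive_set nbI_axioms :: "'v fm set" where
  Ax1: "Imp \<alpha> (Imp \<beta> \<alpha>) \<in> nbI_axioms"
| Ax2: "Imp (Imp \<alpha> (Imp \<beta> \<gamma>)) (Imp (Imp \<alpha> \<beta>) (Imp \<alpha> \<gamma>)) \<in> nbI_axioms"
| Ax3: "Imp \<alpha> (Imp \<beta> (Conj \<alpha> \<beta>)) \<in> nbI_axioms"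
| Ax4: "Imp (Conj \<alpha> \<beta>) \<alpha> \<in> nbI_axioms"
| Ax5: "Imp (Conj \<alpha> \<beta>) \<beta> \<in> nbI_axioms"
| Ax6: "Imp \<alpha> (Disj \<alpha> \<beta>) \<in> nbI_axioms"
| Ax7: "Imp \<beta> (Disj \<alpha> \<beta>) \<in> nbI_axioms"
| Ax8: "Imp (Imp \<alpha> \<gamma>) (Imp (Imp \<beta> \<gamma>) (Imp (Disj \<alpha> \<beta>) \<gamma>)) \<in> nbI_axioms"
| Ax9: "Disj (Imp \<alpha> \<beta>) \<alpha> \<in> nbI_axioms"
| Ip: "Imp (Inc \<alpha> \<beta>) (Imp \<alpha> (Imp \<beta> \<gamma>)) \<in> nbI_axioms"
| Comm: "Imp (Inc \<alpha> \<beta>) (Inc \<beta> \<alpha>) \<in> nbI_axioms"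
| Ax11: "Disj \<alpha> (Neg \<alpha>) \<in> nbI_axioms"

inductive nbI_derives :: "'v fm set \<Rightarrow> 'v fm \<Rightarrow> bool" (infix \<open>\<turnstile>\<close> 50) for \<Gamma> where
  premise: "\<phi> \<in> \<Gamma> \<Longrightarrow> \<Gamma> \<turnstile> \<phi>"
| axiom: "\<phi> \<in> nbI_axioms \<Longrightarrow> \<Gamma> \<turnstile> \<phi>"
| modus_ponens: "\<Gamma> \<turnstile> \<phi> \<Longrightarrow> \<Gamma> \<turnstile> Imp \<phi> \<psi> \<Longrightarrow> \<Gamma> \<turnstile> \<psi>"

text \<open>
  The operations of the multialgebra are total functions on the type \<open>'a\<close>;
  only their values on the universe are constrained and used.
\<close>

record 'a nmatrix =
  universe :: "'a set"
  designated :: "'a set"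
  disj_op :: "'a \<Rightarrow> 'a \<Rightarrow> 'a set"
  conj_op :: "'a \<Rightarrow> 'a \<Rightarrow> 'a set"
  imp_op :: "'a \<Rightarrow> 'a \<Rightarrow> 'a set"
  inc_op :: "'a \<Rightarrow> 'a \<Rightarrow> 'a set"
  neg_op :: "'a \<Rightarrow> 'a set"

definition multiop1 :: "'a set \<Rightarrow> ('a \<Rightarrow> 'a set) \<Rightarrow> bool" where
  "multiop1 A f \<longleftrightarrow> (\<forall>a\<in>A. f a \<subseteq> A \<and> f a \<noteq> {})"

definition multiop2 :: "'a set \<Rightarrow> ('a \<Rightarrow> 'a \<Rightarrow> 'a set) \<Rightarrow> bool" where
  "multiop2 A f \<longleftrightarrow> (\<forall>a\<in>A. \<forall>b\<in>A. f a b \<subseteq> A \<and> f a b \<noteq> {})"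

definition is_nmatrix :: "'a nmatrix \<Rightarrow> bool" where
  "is_nmatrix M \<longleftrightarrow>
     designated M \<subset> universe M \<and> designated M \<noteq> {} \<and>
     multiop2 (universe M) (disj_op M) \<and>
     multiop2 (universe M) (conj_op M) \<and>
     multiop2 (universe M) (imp_op M) \<and>
     multiop2 (universe M) (inc_op M) \<and>
     multiop1 (universe M) (neg_op M)"

definition valuation :: "'a nmatrix \<Rightarrow> ('v fm \<Rightarrow> 'a) \<Rightarrow> bool" where
  "valuation M \<nu> \<longleftrightarrow>
     (\<forall>\<phi>. \<nu> \<phi> \<in> universe M) \<and>
     (\<forall>\<phi> \<psi>. \<nu> (Disj \<phi> \<psi>) \<in> disj_op M (\<nu> \<phi>) (\<nu> \<psi>)) \<and>
     (\<forall>\<phi> \<psi>. \<nu> (Conj \<phi> \<psi>) \<in> conj_op M (\<nu> \<phi>) (\<nu> \<psi>)) \<and>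
     (\<forall>\<phi> \<psi>. \<nu> (Imp \<phi> \<psi>) \<in> imp_op M (\<nu> \<phi>) (\<nu> \<psi>)) \<and>
     (\<forall>\<phi> \<psi>. \<nu> (Inc \<phi> \<psi>) \<in> inc_op M (\<nu> \<phi>) (\<nu> \<psi>)) \<and>
     (\<forall>\<phi>. \<nu> (Neg \<phi>) \<in> neg_op M (\<nu> \<phi>))"

definition nm_entails :: "'v fm set \<Rightarrow> 'a nmatrix \<Rightarrow> 'v fm \<Rightarrow> bool" where
  "nm_entails \<Gamma> M \<phi> \<longleftrightarrow>
     (\<forall>\<nu>. valuation M \<nu> \<longrightarrow> (\<forall>\<gamma>\<in>\<Gamma>. \<nu> \<gamma> \<in> designated M) \<longrightarrow> \<nu> \<phi> \<in> designated M)"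

end

theory Submission
  imports Defs
begin

text \<open>
  The commutativity axiom forces any characterizing Nmatrix to be deterministic, up to
  designation, on the diagonal of \<open>\<up>\<close>: if two distinct variables \<open>x\<close>, \<open>y\<close> receive the same value
  \<open>a\<close>, then the formulas \<open>x \<up> y\<close>, \<open>y \<up> x\<close> and \<open>x \<up> x\<close> all draw their values from the same set
  \<open>a \<up> a\<close>. A value of \<open>x \<up> x\<close> may therefore be transplanted to \<open>y \<up> x\<close>, and since
  \<open>x \<up> y \<turnstile> y \<up> x\<close>, it must be designated whenever the value of \<open>x \<up> y\<close> is
  (lemma \<open>Inc_diagonal_designated\<close>).

  With finitely many values and infinitely many variables, two distinct variables always share a
  value. So the Nmatrix cannot make \<open>x \<up> y\<close> designated for all distinct \<open>x\<close>, \<open>y\<close> while leaving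
  \<open>x \<up> x\<close> undesignated for every \<open>x\<close>. The calculus allows exactly this: when all variables are
  false, its axioms put only symmetry on \<open>\<up>\<close> between them, so \<open>\<up>\<close> may be inequality
  (lemma \<open>diversity_sound\<close>). To phrase the situation as a consequence with one
  conclusion, the premises (set \<open>diversity_premises\<close>) include \<open>(x \<up> x) \<rightarrow> q\<close> for every \<open>x\<close>, with
  conclusion \<open>q\<close>; this consequence holds in the Nmatrix and is not derivable.
\<close>

section \<open>A bivaluation interpreting incompatibility of variables as inequality\<close>

text \<open>
  Falsity of all variables makes the explosion axiom for \<open>\<up>\<close> vacuous, and the relation of
  being two distinct variables is symmetric. Negation may be constantly true because only the
  excluded middle constrains it.
\<close>

primrec diversity :: "'v fm \<Rightarrow> bool" where
  "diversity (Var x) = False"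
| "diversity (Disj \<phi> \<psi>) = (diversity \<phi> \<or> diversity \<psi>)"
| "diversity (Conj \<phi> \<psi>) = (diversity \<phi> \<and> diversity \<psi>)"
| "diversity (Imp \<phi> \<psi>) = (diversity \<phi> \<longrightarrow> diversity \<psi>)"
| "diversity (Inc \<phi> \<psi>) = (\<exists>x y. \<phi> = Var x \<and> \<psi> = Var y \<and> x \<noteq> y)"
| "diversity (Neg \<phi>) = True"

lemma diversity_axiom: "\<phi> \<in> nbI_axioms \<Longrightarrow> diversity \<phi>"
  by (induction rule: nbI_axioms.induct) auto

lemma diversity_sound:
  assumes "\<Gamma> \<turnstile> \<phi>" and "\<And>\<gamma>. \<gamma> \<in> \<Gamma> \<Longrightarrow> diversity \<gamma>"
  shows "diversity \<phi>"
  using assms by (induction rule: nbI_derives.induct) (auto intro: diversity_axiom)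

definition diversity_premises :: "'v \<Rightarrow> 'v fm set" where
  "diversity_premises q =
     {Inc (Var x) (Var y) | x y. x \<noteq> y} \<union> {Imp (Inc (Var x) (Var x)) (Var q) | x. True}"

lemma diversity_premises_not_derives: "\<not> diversity_premises q \<turnstile> Var q"
proof
  assume "diversity_premises q \<turnstile> Var q"
  then have "diversity (Var q)"
    by (rule diversity_sound) (auto simp: diversity_premises_def)
  then show False by simp
qed

section \<open>Determinism of incompatibility on the diagonal\<close>

text \<open>
  Composing a valuation \<open>\<nu>\<close> with this map gives \<open>y \<up> x\<close> the value of \<open>x \<up> x\<close>. If \<open>\<nu>\<close>
  identifies \<open>x\<close> and \<open>y\<close>, the result is again a valuation, which is a way to choose a new value
  for one formula without extending the choice by hand to all formulas built from it.
\<close>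

primrec transplant :: "'v \<Rightarrow> 'v \<Rightarrow> 'v fm \<Rightarrow> 'v fm" where
  "transplant x y (Var z) = Var z"
| "transplant x y (Disj \<phi> \<psi>) = Disj (transplant x y \<phi>) (transplant x y \<psi>)"
| "transplant x y (Conj \<phi> \<psi>) = Conj (transplant x y \<phi>) (transplant x y \<psi>)"
| "transplant x y (Imp \<phi> \<psi>) = Imp (transplant x y \<phi>) (transplant x y \<psi>)"
| "transplant x y (Inc \<phi> \<psi>) =
     (if \<phi> = Var y \<and> \<psi> = Var x then Inc (Var x) (Var x)
      else Inc (transplant x y \<phi>) (transplant x y \<psi>))"
| "transplant x y (Neg \<phi>) = Neg (transplant x y \<phi>)"

lemma valuation_transplant:
  assumes "valuation M \<nu>" and "\<nu> (Var x) = \<nu> (Var y)"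
  shows "valuation M (\<lambda>\<phi>. \<nu> (transplant x y \<phi>))"
proof -
  have "\<nu> (Inc (Var x) (Var x)) \<in> inc_op M (\<nu> (Var y)) (\<nu> (Var x))"
    using assms unfolding valuation_def by metis
  then show ?thesis
    using assms(1) by (auto simp: valuation_def)
qed

lemma Inc_diagonal_designated:
  assumes comm: "nm_entails {Inc (Var x) (Var y)} M (Inc (Var y) (Var x))"
    and val: "valuation M \<nu>" and same: "\<nu> (Var x) = \<nu> (Var y)" and "x \<noteq> y"
    and "\<nu> (Inc (Var x) (Var y)) \<in> designated M"
  shows "\<nu> (Inc (Var x) (Var x)) \<in> designated M"
proof -
  let ?\<mu> = "\<lambda>\<phi>. \<nu> (transplant x y \<phi>)"
  have "?\<mu> (Inc (Var x) (Var y)) \<in> designated M"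
    using assms by simp
  then have "?\<mu> (Inc (Var y) (Var x)) \<in> designated M"
    using comm valuation_transplant[OF val same] unfolding nm_entails_def by blast
  then show ?thesis by simp
qed

section \<open>No finite characterizing Nmatrix\<close>

lemma finite_nmatrix_entails_diversity:
  fixes M :: "'a nmatrix" and q :: 'v
  assumes "infinite (UNIV :: 'v set)" and fin: "finite (universe M)"
    and sound: "\<And>(\<Gamma> :: 'v fm set) \<phi>. \<Gamma> \<turnstile> \<phi> \<Longrightarrow> nm_entails \<Gamma> M \<phi>"
  shows "nm_entails (diversity_premises q) M (Var q)"
  unfolding nm_entails_def
proof (intro allI impI)
  fix \<nu> :: "'v fm \<Rightarrow> 'a"
  assume val: "valuation M \<nu>"
    and prem: "\<forall>\<gamma>\<in>diversity_premises q. \<nu> \<gamma> \<in> designated M"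
  have "range (\<lambda>x. \<nu> (Var x)) \<subseteq> universe M"
    using val by (auto simp: valuation_def)
  then have "finite (range (\<lambda>x. \<nu> (Var x)))"
    using fin by (rule finite_subset)
  then have "\<not> inj (\<lambda>x. \<nu> (Var x))"
    using assms(1) finite_imageD by blast
  then obtain x y where "x \<noteq> y" and same: "\<nu> (Var x) = \<nu> (Var y)"
    by (auto simp: inj_on_def)
  have "{Inc (Var x) (Var y)} \<turnstile> Inc (Var y) (Var x)"
    by (rule modus_ponens[OF premise axiom[OF Comm]]) simp
  then have diag: "\<nu> (Inc (Var x) (Var x)) \<in> designated M"
    using prem \<open>x \<noteq> y\<close>
    by (intro Inc_diagonal_designated[OF sound val same]) (auto simp: diversity_premises_def)
  have "{Inc (Var x) (Var x), Imp (Inc (Var x) (Var x)) (Var q)} \<turnstile> Var q"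
    by (rule modus_ponens[OF premise premise]) simp_all
  from sound[OF this] show "\<nu> (Var q) \<in> designated M"
    using val diag prem by (auto simp: nm_entails_def diversity_premises_def)
qed

theorem mainTheorem13:
  assumes "countable (UNIV :: 'v set)" and "infinite (UNIV :: 'v set)"
  shows "\<not> (\<exists>M :: 'a nmatrix. is_nmatrix M \<and> finite (universe M) \<and>
           (\<forall>(\<Gamma> :: 'v fm set) (\<phi> :: 'v fm). \<Gamma> \<turnstile> \<phi> \<longleftrightarrow> nm_entails \<Gamma> M \<phi>))"
proof
  assume "\<exists>M :: 'a nmatrix. is_nmatrix M \<and> finite (universe M) \<and>
           (\<forall>(\<Gamma> :: 'v fm set) (\<phi> :: 'v fm). \<Gamma> \<turnstile> \<phi> \<longleftrightarrow> nm_entails \<Gamma> M \<phi>)"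
  then obtain M :: "'a nmatrix" where "finite (universe M)"
    and char: "\<And>(\<Gamma> :: 'v fm set) \<phi>. \<Gamma> \<turnstile> \<phi> \<longleftrightarrow> nm_entails \<Gamma> M \<phi>"
    by blast
  then have "nm_entails (diversity_premises q) M (Var q)" for q :: 'v
    by (intro finite_nmatrix_entails_diversity[OF assms(2)]) simp_all
  then show False
    unfolding char[symmetric] using diversity_premises_not_derives by (rule notE[rotated])
qed

end
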